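(* Let $\widehat E,\widehat F\in\mathbb{D}_n^{\rm CM}$. If $\widehat E\overset{{\rm DM}\text{-}\#}{\leq}\widehat F$ (Dual-minus sharp partial order), then $\widehat E\overset{\rm D}{\leq}\widehat F$ (Dual-minus partial order).
   Context: $\varepsilon$ is the dual unit: $\varepsilon\neq 0$, $\varepsilon^2=0$, commuting with reals. $\mathbb{D}^{m\times n}$ is the set of $m\times n$ dual matrices $\widehat E=E+\varepsilon E_0$ with $E,E_0\in\mathbb{R}^{m\times n}$, with the obvious addition, multiplication and transpose $\widehat E^{T}=E^T+\varepsilon E_0^T$. The dual Moore-Penrose generalized inverse (DMPGI) of $\widehat E\in\mathbb{D}^{m\times n}$ is the unique $\widehat X\in\mathbb{D}^{n\times m}$, if it exists, with $\widehat E\widehat X\widehat E=\widehat E$, $\widehat X\widehat E\widehat X=\widehat X$, $(\widehat E\widehat X)^T=\widehat E\widehat X$, $(\widehat X\widehat E)^T=\widehat X\widehat E$. The dual group generalized inverse (DGGI) of $\widehat E\in\mathbb{D}^{n\times n}$ is the $\widehat X\in\mathbb{D}^{n\times n}$, if it exists, with $\widehat E\widehat X\widehat E=\widehat E$, $\widehat X\widehat E\widehat X=\widehat X$, $\widehat E\widehat X=\widehat X\widehat E$. $\mathbb{D}_n^{\rm CM}$ is the set of dual matrices in $\mathbb{D}^{n\times n}$ of dual index one, i.e. (equivalently) those whose DGGI exists; for $\widehat E=E+\varepsilon E_0\in\mathbb{D}_n^{\rm CM}$ the DMPGI of $\widehat E$ exists and $\mathrm{rk}(E^2)=\mathrm{rk}(E)$.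 Minus partial order on real matrices of the same size: $E\leq F$ means $\mathrm{rk}(F-E)=\mathrm{rk}(F)-\mathrm{rk}(E)$. Sharp partial order: for real $n\times n$ matrices $E,F$ with $\mathrm{rk}(E^2)=\mathrm{rk}(E)$ and $\mathrm{rk}(F^2)=\mathrm{rk}(F)$, $E\overset{\#}{\leq}F$ means $EF=E^2=FE$. Dual-minus partial order: for dual matrices $\widehat E=E+\varepsilon E_0,\widehat F=F+\varepsilon F_0$ of the same size whose DMPGIs exist, $\widehat E\overset{\rm D}{\leq}\widehat F$ means that $E\leq F$ and the DMPGI of $\widehat F-\widehat E$ exists. Dual-minus sharp partial order: for $\widehat E,\widehat F\in\mathbb{D}_n^{\rm CM}$, $\widehat E\overset{{\rm DM}\text{-}\#}{\leq}\widehat F$ means that $E\overset{\#}{\leq}F$ and the DMPGI of $\widehat F-\widehat E$ exists. *)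

theory Defs
  imports "HOL-Analysis.Analysis"
begin

text \<open>The ring of dual numbers \<open>a + \<epsilon> b\<close> over the reals; \<open>Dual a b\<close> stands for \<open>a + \<epsilon> b\<close>.\<close>

datatype dualnum = Dual (std_part: real) (eps_part: real)

instantiation dualnum :: "{comm_ring_1, real_algebra_1}"
begin

definition "0 = Dual 0 0"
definition "1 = Dual 1 0"
definition "x + y = Dual (std_part x + std_part y) (eps_part x + eps_part y)"
definition "- x = Dual (- std_part x) (- eps_part x)"
definition "x - y = Dual (std_part x - std_part y) (eps_part x - eps_part y)"
definition "x * y = Dual (std_part x * std_part y)
                         (std_part x * eps_part y + eps_part x * std_part y)"
definition "scaleR r x = Dual (r * std_part x) (r * eps_part x)"

instance
  by standard
     (simp_all add: zero_dualnum_def one_dualnum_def plus_dualnum_def uminus_dualnum_def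
        minus_dualnum_def times_dualnum_def scaleR_dualnum_def algebra_simps)

end

definition dual_eps :: dualnum where
  "dual_eps = Dual 0 1"

lemma dual_eps_nonzero: "dual_eps \<noteq> 0"
  by (simp add: dual_eps_def zero_dualnum_def)

lemma dual_eps_square: "dual_eps * dual_eps = 0"
  by (simp add: dual_eps_def times_dualnum_def zero_dualnum_def)

lemma Dual_eq: "Dual a b = of_real a + dual_eps * of_real b"
  by (simp add: of_real_def dual_eps_def plus_dualnum_def times_dualnum_def
      scaleR_dualnum_def one_dualnum_def)

text \<open>A dual \<open>m \<times> n\<close> matrix is an element of \<^typ>\<open>dualnum^'n^'m\<close>; addition, multiplication
  and transpose are the library operations. The real matrix \<open>E\<close> in \<open>E + \<epsilon> E\<^sub>0\<close>:\<close>

definition std_mat :: "dualnum^'n^'m \<Rightarrow> real^'n^'m" where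
  "std_mat A = (\<chi> i j. std_part (A $ i $ j))"

definition is_DMPGI :: "dualnum^'n^'m \<Rightarrow> dualnum^'m^'n \<Rightarrow> bool" where
  "is_DMPGI E X \<longleftrightarrow>
     E ** X ** E = E \<and>
     X ** E ** X = X \<and>
     transpose (E ** X) = E ** X \<and>
     transpose (X ** E) = X ** E"

definition has_DMPGI :: "dualnum^'n^'m \<Rightarrow> bool" where
  "has_DMPGI E \<longleftrightarrow> (\<exists>X. is_DMPGI E X)"

text \<open>Existence alone is the right condition in \<^const>\<open>has_DMPGI\<close>, since uniqueness is automatic:\<close>

lemma is_DMPGI_unique:
  assumes "is_DMPGI E X" "is_DMPGI E Y"
  shows "X = Y"
proof -
  have X: "E ** X ** E = E" "X ** E ** X = X"
          "transpose (E ** X) = E ** X" "transpose (X ** E) = X ** E"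
    and Y: "E ** Y ** E = E" "Y ** E ** Y = Y"
          "transpose (E ** Y) = E ** Y" "transpose (Y ** E) = Y ** E"
    using assms by (simp_all add: is_DMPGI_def)
  have "E ** X = (E ** Y) ** (E ** X)"
    by (metis Y(1) matrix_mul_assoc)
  also have "\<dots> = transpose ((E ** X) ** (E ** Y))"
    by (metis matrix_transpose_mul X(3) Y(3))
  also have "\<dots> = E ** Y"
    by (metis X(1) Y(3) matrix_mul_assoc)
  finally have l: "E ** X = E ** Y" .
  have "X ** E = (X ** E) ** (Y ** E)"
    by (metis Y(1) matrix_mul_assoc)
  also have "\<dots> = transpose ((Y ** E) ** (X ** E))"
    by (metis matrix_transpose_mul X(4) Y(4))
  also have "\<dots> = Y ** E"
    by (metis X(1) Y(4) matrix_mul_assoc)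
  finally have r: "X ** E = Y ** E" .
  show ?thesis
    by (metis X(2) Y(2) l r matrix_mul_assoc)
qed

definition is_DGGI :: "dualnum^'n^'n \<Rightarrow> dualnum^'n^'n \<Rightarrow> bool" where
  "is_DGGI E X \<longleftrightarrow> E ** X ** E = E \<and> X ** E ** X = X \<and> E ** X = X ** E"

text \<open>Dual matrices of dual index one, i.e. those having a dual group inverse.\<close>

definition dual_CM :: "(dualnum^'n^'n) set" where
  "dual_CM = {E. \<exists>X. is_DGGI E X}"

text \<open>The rank difference is taken in \<^typ>\<open>int\<close>, as subtraction on \<^typ>\<open>nat\<close> truncates.\<close>

definition minus_le :: "real^'n^'m \<Rightarrow> real^'n^'m \<Rightarrow> bool" where
  "minus_le E F \<longleftrightarrow> int (rank (F - E)) = int (rank F) - int (rank E)"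

text \<open>The remaining orders are partial relations in the literature: each is only declared on a
  certain class of matrices, and membership in that class is part of the relation here.\<close>

definition sharp_le :: "real^'n^'n \<Rightarrow> real^'n^'n \<Rightarrow> bool" where
  "sharp_le E F \<longleftrightarrow>
     rank (E ** E) = rank E \<and> rank (F ** F) = rank F \<and>
     E ** F = E ** E \<and> E ** E = F ** E"

definition dual_minus_le :: "dualnum^'n^'m \<Rightarrow> dualnum^'n^'m \<Rightarrow> bool" where
  "dual_minus_le E F \<longleftrightarrow>
     has_DMPGI E \<and> has_DMPGI F \<and>
     minus_le (std_mat E) (std_mat F) \<and> has_DMPGI (F - E)"

definition dual_minus_sharp_le :: "dualnum^'n^'n \<Rightarrow> dualnum^'n^'n \<Rightarrow> bool" where
  "dual_minus_sharp_le E F \<longleftrightarrow>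
     E \<in> dual_CM \<and> F \<in> dual_CM \<and>
     sharp_le (std_mat E) (std_mat F) \<and> has_DMPGI (F - E)"

end

theory Submission
  imports Defs
begin

text \<open>
  Group invertibility gives an inner inverse \<open>X\<close> of \<open>E\<close>, and over the dual numbers an
  inner inverse already yields the Moore-Penrose inverse. For an idempotent \<open>P\<close>, Kaplansky's
  element \<open>Z = 1 - (P - P\<^sup>T)\<^sup>2\<close> has standard part of the form \<open>1 + S\<^sup>T S\<close>, hence is
  invertible, and \<open>P P\<^sup>T Z\<^sup>-\<^sup>1\<close> is the orthogonal projection with the same range as \<open>P\<close>.
  Replacing \<open>E X\<close> and \<open>X E\<close> by orthogonal projections in this way turns \<open>X\<close> into the
  Moore-Penrose inverse. For the real parts, \<open>E F = E\<^sup>2 = F E\<close> and \<open>rank E\<^sup>2 = rank E\<close> make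
  the range of \<open>F\<close> the direct sum of the ranges of \<open>E\<close> and \<open>F - E\<close>.
\<close>

section \<open>Matrix algebra and standard parts\<close>

lemma matrix_diff_ldistrib: "A ** (B - C) = A ** B - A ** C"
  for A :: "'a::ring_1^'n^'m" and B C :: "'a^'k^'n"
  by (simp add: matrix_matrix_mult_def vec_eq_iff right_diff_distrib sum_subtractf)

lemma matrix_diff_rdistrib: "(A - B) ** C = A ** C - B ** C"
  for A B :: "'a::ring_1^'n^'m" and C :: "'a^'k^'n"
  by (simp add: matrix_matrix_mult_def vec_eq_iff left_diff_distrib sum_subtractf)

lemma matrix_add_rdistrib: "(A + B) ** C = A ** C + B ** C"
  for A B :: "'a::semiring_1^'n^'m" and C :: "'a^'k^'n"
  by (simp add: matrix_matrix_mult_def vec_eq_iff distrib_right sum.distrib)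

lemma transpose_diff: "transpose (A - B) = transpose A - transpose B"
  by (simp add: transpose_def vec_eq_iff)

lemma eq_matrix_inverse:
  fixes A :: "'a::semiring_1^'n^'n"
  assumes "L ** A = mat 1" "A ** R = mat 1"
  shows "L = R"
  by (metis assms matrix_mul_assoc matrix_mul_lid matrix_mul_rid)

lemma std_part_sum: "std_part (sum f A) = (\<Sum>i\<in>A. std_part (f i))"
  by (induction A rule: infinite_finite_induct) (simp_all add: zero_dualnum_def plus_dualnum_def)

lemma std_mat_mult: "std_mat (A ** B) = std_mat A ** std_mat B"
  by (simp add: std_mat_def matrix_matrix_mult_def vec_eq_iff std_part_sum times_dualnum_def)

lemma std_mat_diff: "std_mat (A - B) = std_mat A - std_mat B"
  by (simp add: std_mat_def vec_eq_iff minus_dualnum_def)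

lemma std_mat_1: "std_mat (mat 1) = mat 1"
  by (simp add: std_mat_def mat_def vec_eq_iff one_dualnum_def zero_dualnum_def)

lemma std_mat_transpose: "std_mat (transpose A) = transpose (std_mat A)"
  by (simp add: std_mat_def transpose_def vec_eq_iff)

lemma std_mat_surj: obtains V where "std_mat V = A"
proof
  show "std_mat (\<chi> i j. Dual (A $ i $ j) 0) = A"
    by (simp add: std_mat_def vec_eq_iff)
qed

section \<open>Lifting invertibility from the standard part\<close>

lemma std_mat_0_mult_eq_0:
  assumes "std_mat A = 0" "std_mat B = 0"
  shows "A ** B = 0"
proof -
  have "std_part (A $ i $ j) = 0" for i j
    using assms(1) by (simp add: std_mat_def vec_eq_iff)
  moreover have "std_part (B $ i $ j) = 0" for i j
    using assms(2) by (simp add: std_mat_def vec_eq_iff)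
  ultimately have "A $ i $ k * B $ k $ j = 0" for i j k
    by (simp add: times_dualnum_def zero_dualnum_def)
  then show ?thesis
    by (simp add: matrix_matrix_mult_def vec_eq_iff)
qed

text \<open>\<open>N = U - mat 1\<close> squares to zero, so the Neumann series for the inverse of
  \<open>U\<close> stops at \<open>mat 1 - N\<close>.\<close>

lemma unipotent_dual_invertible:
  fixes U :: "dualnum^'n^'n"
  assumes "std_mat U = mat 1"
  obtains W where "W ** U = mat 1" "U ** W = mat 1"
proof -
  define N where "N = U - mat 1"
  have NN: "N ** N = 0"
    by (rule std_mat_0_mult_eq_0) (simp_all add: N_def std_mat_diff std_mat_1 assms)
  have U: "U = mat 1 + N"
    by (simp add: N_def)
  have "(mat 1 - N) ** U = mat 1" "U ** (mat 1 - N) = mat 1"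
    by (simp_all add: U matrix_diff_ldistrib matrix_diff_rdistrib matrix_add_ldistrib
        matrix_add_rdistrib NN)
  then show thesis
    by (rule that)
qed

text \<open>Any lift \<open>V\<close> of the real inverse makes \<open>V ** Z\<close> and
  \<open>Z ** V\<close> unipotent; inverting these corrects \<open>V\<close> to a left and a right
  inverse.\<close>

lemma dual_invertible_if_std_invertible:
  fixes Z :: "dualnum^'n^'n"
  assumes "invertible (std_mat Z)"
  shows "invertible Z"
proof -
  obtain B where B: "std_mat Z ** B = mat 1" "B ** std_mat Z = mat 1"
    using assms by (auto simp: invertible_def)
  obtain V where V: "std_mat V = B"
    by (rule std_mat_surj)
  obtain L where "L ** (V ** Z) = mat 1"
    by (rule unipotent_dual_invertible[of "V ** Z"]) (simp add: std_mat_mult V B)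
  then have L: "(L ** V) ** Z = mat 1"
    by (simp add: matrix_mul_assoc)
  obtain R where "(Z ** V) ** R = mat 1"
    by (rule unipotent_dual_invertible[of "Z ** V"]) (simp add: std_mat_mult V B)
  then have "Z ** (V ** R) = mat 1"
    by (simp add: matrix_mul_assoc)
  then show ?thesis
    using L eq_matrix_inverse[OF L] by (auto simp: invertible_def)
qed

section \<open>Orthogonal projections and the Moore-Penrose inverse\<close>

lemma invertible_one_minus_skew_square:
  fixes S :: "real^'n^'n"
  assumes skew: "transpose S = - S"
  shows "invertible (mat 1 - S ** S)"
proof -
  have "x = 0" if "(mat 1 - S ** S) *v x = 0" for x
  proof -
    \<comment> \<open>For a kernel vector, skewness turns \<open>x \<bullet> x\<close> into minus
      the squared norm of \<open>S *v x\<close>, which forces \<open>x = 0\<close>.\<close>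
    have "x = S *v (S *v x)"
      using that by (simp add: matrix_vector_mult_diff_rdistrib matrix_vector_mul_assoc)
    then have "x \<bullet> x = x \<bullet> (S *v (S *v x))"
      by simp
    also have "\<dots> = (transpose S *v x) \<bullet> (S *v x)"
      by (simp add: dot_lmul_matrix)
    also have "\<dots> = - ((S *v x) \<bullet> (S *v x))"
    proof -
      have "(- S) *v x = - (S *v x)"
        using matrix_vector_mult_diff_rdistrib[of 0 S x] by simp
      then show ?thesis
        unfolding skew by simp
    qed
    finally show "x = 0"
      by (metis inner_ge_zero inner_eq_zero_iff neg_le_0_iff_le order_antisym)
  qed
  then show ?thesis
    by (metis invertible_left_inverse matrix_left_invertible_ker)
qed

lemma orthogonal_projection_of_idempotent:
  fixes P :: "dualnum^'n^'n"
  assumes idem: "P ** P = P"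
  obtains Q where "transpose Q = Q" "Q ** P = P" "P ** Q = Q"
proof -
  define T where "T = transpose P"
  define Z where "Z = mat 1 - (P - T) ** (P - T)"
  have TT: "T ** T = T"
    unfolding T_def by (metis idem matrix_transpose_mul)
  have tT: "transpose T = P" "transpose P = T"
    by (simp_all add: T_def)
  have "transpose (std_mat (P - T)) = - std_mat (P - T)"
    by (simp add: T_def std_mat_diff std_mat_transpose transpose_diff)
  then have "invertible (std_mat Z)"
    unfolding Z_def std_mat_diff[of "mat 1"] std_mat_mult std_mat_1
    by (rule invertible_one_minus_skew_square)
  then obtain W where ZW: "Z ** W = mat 1" and WZ: "W ** Z = mat 1"
    using dual_invertible_if_std_invertible by (auto simp: invertible_def)
  have Z_eq: "Z = mat 1 - P + P ** T + T ** P - T"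
    by (simp add: Z_def matrix_diff_ldistrib matrix_diff_rdistrib idem TT)
  have PTT: "A ** P ** P = A ** P" "A ** T ** T = A ** T" for A :: "dualnum^'n^'n"
    by (simp_all add: idem TT flip: matrix_mul_assoc)
  \<comment> \<open>\<open>Z\<close> commutes with \<open>P\<close> and \<open>T\<close>, hence so
    does its inverse \<open>W\<close>.\<close>
  have PZ: "P ** Z = P ** T ** P" and ZP: "Z ** P = P ** T ** P"
    and TZ: "T ** Z = T ** P ** T" and ZT: "Z ** T = T ** P ** T"
    by (simp_all add: Z_eq matrix_diff_ldistrib matrix_diff_rdistrib matrix_add_ldistrib
        matrix_add_rdistrib matrix_mul_assoc idem TT PTT)
  have WP: "W ** P = P ** W"
    by (metis PZ ZP ZW WZ matrix_mul_assoc matrix_mul_lid matrix_mul_rid)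
  have WT: "W ** T = T ** W"
    by (metis TZ ZT ZW WZ matrix_mul_assoc matrix_mul_lid matrix_mul_rid)
  have tZ: "transpose Z = Z"
    by (simp add: Z_def transpose_diff matrix_transpose_mul tT matrix_diff_ldistrib
        matrix_diff_rdistrib)
  have tW: "transpose W = W"
  proof (rule eq_matrix_inverse[OF _ ZW])
    show "transpose W ** Z = mat 1"
      by (metis ZW matrix_transpose_mul tZ transpose_mat)
  qed
  show thesis
  proof
    show "transpose (P ** T ** W) = P ** T ** W"
      by (simp add: matrix_transpose_mul tT tW) (metis WP WT matrix_mul_assoc)
    \<comment> \<open>Moving \<open>W\<close> to the right leaves
      \<open>P ** T ** P ** W = P ** Z ** W\<close>.\<close>
    show "(P ** T ** W) ** P = P"
      by (metis PZ WP ZW matrix_mul_assoc matrix_mul_rid)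
    show "P ** (P ** T ** W) = P ** T ** W"
      by (simp add: matrix_mul_assoc idem)
  qed
qed

lemma has_DMPGI_if_inner_inverse:
  fixes E :: "dualnum^'n^'m"
  assumes EXE: "E ** X ** E = E"
  shows "has_DMPGI E"
proof -
  have "(E ** X) ** (E ** X) = E ** X"
    by (simp add: EXE matrix_mul_assoc)
  then obtain Q where Q: "transpose Q = Q" "Q ** (E ** X) = E ** X" "(E ** X) ** Q = Q"
    by (rule orthogonal_projection_of_idempotent)
  \<comment> \<open>\<open>R\<close> must fix \<open>X ** E\<close> from the right, so the
    projection is built for the transpose.\<close>
  have "transpose (X ** E) ** transpose (X ** E) = transpose (X ** E)"
    by (metis EXE matrix_mul_assoc matrix_transpose_mul)
  then obtain R where R: "transpose R = R" "R ** transpose (X ** E) = transpose (X ** E)"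
      "transpose (X ** E) ** R = R"
    by (rule orthogonal_projection_of_idempotent)
  have XER: "(X ** E) ** R = X ** E" and RXE: "R ** (X ** E) = R"
    using R by (metis matrix_transpose_mul transpose_transpose)+
  have ER: "E ** R = E"
    by (metis EXE XER matrix_mul_assoc)
  have QE: "Q ** E = E"
    by (metis EXE Q(2) matrix_mul_assoc)
  \<comment> \<open>\<open>R ** X ** Q\<close> is the Moore-Penrose inverse: its products with
    \<open>E\<close> are the symmetric \<open>Q\<close> and \<open>R\<close>.\<close>
  have EY: "E ** (R ** X ** Q) = Q"
    by (metis ER Q(3) matrix_mul_assoc)
  have YE: "(R ** X ** Q) ** E = R"
    by (metis QE RXE matrix_mul_assoc)
  have RR: "R ** R = R"
    by (metis RXE XER matrix_mul_assoc)
  have "is_DMPGI E (R ** X ** Q)"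
    unfolding is_DMPGI_def EY YE by (simp add: QE Q(1) R(1) RR matrix_mul_assoc)
  then show ?thesis
    by (auto simp: has_DMPGI_def)
qed

section \<open>Real matrices: from the sharp order to the minus order\<close>

lemma subspace_range_matrix: "subspace (range ((*v) A))"
  for A :: "real^'n^'m"
  by (simp add: linear_subspace_image)

lemma range_square_eq_range:
  fixes E :: "real^'n^'n"
  assumes "rank (E ** E) = rank E"
  shows "range ((*v) (E ** E)) = range ((*v) E)"
proof (rule subspace_dim_equal)
  show "range ((*v) (E ** E)) \<subseteq> range ((*v) E)"
    by (auto simp flip: matrix_vector_mul_assoc)
  show "dim (range ((*v) E)) \<le> dim (range ((*v) (E ** E)))"
    using assms by (simp add: rank_dim_range)
qed (rule subspace_range_matrix)+

text \<open>Passing to the transpose, \<open>E\<^sup>T (E x)\<close> lies in the range of \<open>(E\<^sup>T)\<^sup>2\<close>, which is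
  orthogonal to the kernel of \<open>E\<^sup>2\<close>; this gives \<open>E x \<bullet> E x = 0\<close>.\<close>

lemma ker_square_subset_ker:
  fixes E :: "real^'n^'n"
  assumes rk: "rank (E ** E) = rank E" and E2: "E *v (E *v x) = 0"
  shows "E *v x = 0"
proof -
  let ?T = "transpose E"
  have adj: "u \<bullet> (?T *v v) = (E *v u) \<bullet> v" for u v
    by (metis dot_lmul_matrix transpose_matrix_vector transpose_transpose)
  have "rank (?T ** ?T) = rank ?T"
    by (metis rk matrix_transpose_mul rank_transpose)
  then obtain y where "?T *v (E *v x) = (?T ** ?T) *v y"
    using range_square_eq_range by blast
  then have "(E *v x) \<bullet> (E *v x) = x \<bullet> (?T *v (?T *v y))"
    by (metis adj matrix_vector_mul_assoc)
  also have "\<dots> = 0"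
    by (simp only: adj E2 inner_zero_left)
  finally show ?thesis
    by simp
qed

lemma minus_le_if_sharp_le:
  fixes E F :: "real^'n^'n"
  assumes "sharp_le E F"
  shows "minus_le E F"
proof -
  define G where "G = F - E"
  have rk: "rank (E ** E) = rank E" and EF: "E ** F = E ** E" and FE: "F ** E = E ** E"
    using assms unfolding sharp_le_def by auto
  have EG: "E *v (G *v x) = 0" for x
    by (simp add: G_def matrix_vector_mul_assoc matrix_diff_ldistrib EF)
  have F: "F *v x = E *v x + G *v x" for x
    by (simp add: G_def matrix_vector_mult_diff_rdistrib)
  note sub = subspace_range_matrix
  \<comment> \<open>Index one gives \<open>E\<close> the range of \<open>E ** E\<close>, which is
    \<open>F ** E\<close>.\<close>
  have "range ((*v) E) = range ((*v) (F ** E))"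
    using range_square_eq_range[OF rk] FE by simp
  then have E_F: "range ((*v) E) \<subseteq> range ((*v) F)"
    by (auto simp flip: matrix_vector_mul_assoc)
  have G_F: "G *v y \<in> range ((*v) F)" for y
  proof -
    have "F *v y - E *v y \<in> range ((*v) F)"
      using E_F by (intro subspace_diff[OF sub]) auto
    then show ?thesis
      by (simp add: F)
  qed
  \<comment> \<open>Since \<open>E ** G = 0\<close>, \<open>E\<close> kills a common vector
    \<open>E *v x\<close>, so \<open>x\<close> lies in the kernel of \<open>E ** E\<close>, hence of
    \<open>E\<close>.\<close>
  have "range ((*v) E) \<inter> range ((*v) G) \<subseteq> {0}"
  proof clarsimp
    fix x y
    assume "E *v x = G *v y"
    then have "E *v (E *v x) = 0"
      by (simp only: EG)
    then show "G *v y = 0"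
      using ker_square_subset_ker[OF rk] \<open>E *v x = G *v y\<close> by metis
  qed
  then have "dim (range ((*v) E) \<inter> range ((*v) G)) = 0"
    by (simp only: dim_eq_0)
  moreover have "range ((*v) F) = {x + y |x y. x \<in> range ((*v) E) \<and> y \<in> range ((*v) G)}"
  proof (intro equalityI subsetI)
    show "z \<in> {x + y |x y. x \<in> range ((*v) E) \<and> y \<in> range ((*v) G)}"
      if "z \<in> range ((*v) F)" for z
      using that F by blast
    show "z \<in> range ((*v) F)"
      if "z \<in> {x + y |x y. x \<in> range ((*v) E) \<and> y \<in> range ((*v) G)}" for z
      using that E_F G_F subspace_add[OF sub[of F]] by blast
  qed
  ultimately have "rank F = rank E + rank G"
    using dim_sums_Int[OF sub[of E] sub[of G]] by (simp only: rank_dim_range add_0_right)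
  then show ?thesis
    by (simp add: minus_le_def G_def)
qed

theorem theorem4p3:
  fixes E F :: "dualnum^'n^'n"
  assumes "E \<in> dual_CM" and "F \<in> dual_CM"
    and "dual_minus_sharp_le E F"
  shows "dual_minus_le E F"
  \<comment> \<open>The group inverses of \<open>E\<close> and \<open>F\<close> serve as inner
    inverses; the condition on \<open>F - E\<close> is common to both orders.\<close>
  using assms has_DMPGI_if_inner_inverse minus_le_if_sharp_le
  by (auto simp: dual_minus_le_def dual_minus_sharp_le_def dual_CM_def is_DGGI_def)

end
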